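(* Let $\theta_1,\theta_2,\theta_1',\theta_2'>0$, put $\theta=\theta_1+\theta_2$, let $F_0$ be a baseline distribution function with interval of support $[a,b]$, and let $(Y_1,Y_2)$ have joint distribution function of the form $$F(y_1,y_2)=G(F_0(y_1),F_0(y_2))=\begin{cases}[F_0(y_1)]^{\theta}\,G\Big(1,\dfrac{F_0(y_2)}{F_0(y_1)}\Big) & \text{if } y_1\ge y_2,\\[2mm] [F_0(y_2)]^{\theta}\,G\Big(\dfrac{F_0(y_1)}{F_0(y_2)},1\Big) & \text{if } y_1\le y_2,\end{cases}$$ for all $y_1,y_2$ with $F_0(y_1),F_0(y_2)>0$, where $G(F_0(y_1),1)=F_{Y_1}(y_1)$, $G(1,F_0(y_2))=F_{Y_2}(y_2)$ and $G(1,1)=1$. Suppose that for each $i=1,2$ and all $a<y_i<b$ the marginal distribution function of $Y_i$ is $$F_{Y_i}(y_i)=\frac{\theta_{3-i}}{\theta_i+\theta_{3-i}-\theta_i'}[F_0(y_i)]^{\theta_i'}+\frac{\theta_i-\theta_i'}{\theta_i+\theta_{3-i}-\theta_i'}[F_0(y_i)]^{\theta_i+\theta_{3-i}}\quad\text{if }\theta_1+\theta_2\ne\theta_i',$$ and $$F_{Y_i}(y_i)=[F_0(y_i)]^{\theta_1+\theta_2}\big[1-\theta_{3-i}\ln(F_0(y_i))\big]\quad\text{if }\theta_1+\theta_2=\theta_i'.$$ Then $(Y_1,Y_2)$ has the distribution $\mathrm{BPRHM2}(F_0,\theta_1,\theta_2,\theta_1',\theta_2')$, specified by $$F(y_1,y_2)=\begin{cases}[F_0(y_1)]^{\theta_1+\theta_2}\,F_{Y_2}\Big[F_0^{-1}\Big(\dfrac{F_0(y_2)}{F_0(y_1)}\Big)\Big]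 & \text{if } y_1\ge y_2,\\[2mm] [F_0(y_2)]^{\theta_1+\theta_2}\,F_{Y_1}\Big[F_0^{-1}\Big(\dfrac{F_0(y_1)}{F_0(y_2)}\Big)\Big] & \text{if } y_1\le y_2,\end{cases}$$ for all $y_1,y_2$ with $F_0(y_1),F_0(y_2)>0$.
   Context: The baseline distribution function $F_0$ is that of an absolutely continuous random variable with density $f_0$ and interval of support $[a,b]$, $-\infty\le a<b\le\infty$; it is strictly increasing on $[a,b]$ and takes every value in $(0,1)$, and $F_0^{-1}$ is its inverse (with the value $b$ at $1$, where $F_{Y_i}(b)=1$). $F_{Y_1},F_{Y_2}$ denote the marginal distribution functions of $(Y_1,Y_2)$, which is supported on $[a,b]\times[a,b]$, and $G$ is a function on $[0,1]\times[0,1]$. The bivariate proportional reversed hazards model $\mathrm{BPRHM2}(F_0,\theta_1,\theta_2,\theta_1',\theta_2')$, with all parameters positive, is the bivariate distribution with joint density $$f_{Y_1,Y_2}(y_1,y_2)=\begin{cases}\theta_1'\theta_2 f_0(y_1)f_0(y_2)[F_0(y_1)]^{\theta_1'-1}[F_0(y_2)]^{\theta_1+\theta_2-\theta_1'-1} & \text{if } a<y_1<y_2<b,\\ \theta_1\theta_2' f_0(y_1)f_0(y_2)[F_0(y_1)]^{\theta_1+\theta_2-\theta_2'-1}[F_0(y_2)]^{\theta_2'-1} & \text{if } a<y_2<y_1<b.\end{cases}$$ *)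

theory Defs
  imports "HOL-Probability.Probability"
begin

text \<open>The distribution function at extended real arguments, so that it can be evaluated at
  infinite end points of a support interval: the value is 0 at \<open>-\<infinity>\<close> and, for a probability
  distribution, 1 at \<open>\<infinity>\<close>.\<close>

definition ecdf :: "real measure \<Rightarrow> ereal \<Rightarrow> real" where
  "ecdf D x = measure D {y \<in> space D. ereal y \<le> x}"

lemma ecdf_ereal: "space D = UNIV \<Longrightarrow> ecdf D (ereal x) = cdf D x"
  by (simp add: ecdf_def cdf_def atMost_def)

definition baseline_distribution ::
    "real measure \<Rightarrow> (real \<Rightarrow> real) \<Rightarrow> ereal \<Rightarrow> ereal \<Rightarrow> bool" where
  "baseline_distribution D0 f0 a b \<longleftrightarrow>
     prob_space D0 \<and>
     f0 \<in> borel_measurable borel \<and> (\<forall>x. 0 \<le> f0 x) \<and>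
     D0 = density lborel (\<lambda>x. ennreal (f0 x)) \<and>
     a < b \<and>
     (AE x in D0. a \<le> ereal x \<and> ereal x \<le> b) \<and>
     strict_mono_on {a..b} (ecdf D0)"

text \<open>For a baseline distribution, \<open>ecdf D0\<close> is a bijection from \<open>{a..b}\<close> to \<open>{0..1}\<close>.  Its inverse
  takes the value \<open>b\<close>, possibly \<open>\<infinity>\<close>, at 1.\<close>

definition baseline_inv :: "real measure \<Rightarrow> ereal \<Rightarrow> ereal \<Rightarrow> real \<Rightarrow> ereal" where
  "baseline_inv D0 a b = the_inv_into {a..b} (ecdf D0)"

lemma baseline_inv_1:
  assumes "baseline_distribution D0 f0 a b"
  shows "baseline_inv D0 a b 1 = b"
proof -
  interpret prob_space D0
    using assms unfolding baseline_distribution_def by blast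
  have "D0 = density lborel (\<lambda>x. ennreal (f0 x))" and "a < b"
    and "strict_mono_on {a..b} (ecdf D0)" and AE: "AE x in D0. a \<le> ereal x \<and> ereal x \<le> b"
    using assms unfolding baseline_distribution_def by blast+
  then have D0: "sets D0 = sets borel" "a < b" and inj: "inj_on (ecdf D0) {a..b}"
    by (metis sets_density sets_lborel, blast, metis strict_mono_on_imp_inj_on)
  have "{x \<in> space D0. ereal x \<le> b} \<in> sets D0"
    using D0(1) by measurable
  then have "ecdf D0 b = 1"
    unfolding ecdf_def using AE by (subst prob_Collect_eq_1) auto
  with the_inv_into_f_f[OF inj, of b] D0(2) show ?thesis
    by (simp add: baseline_inv_def)
qed

definition joint_cdf :: "'a measure \<Rightarrow> ('a \<Rightarrow> real) \<Rightarrow> ('a \<Rightarrow> real) \<Rightarrow> real \<Rightarrow> real \<Rightarrow> real" where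
  "joint_cdf M Y1 Y2 y1 y2 = measure M {\<omega> \<in> space M. Y1 \<omega> \<le> y1 \<and> Y2 \<omega> \<le> y2}"

definition bprhm2_density ::
    "(real \<Rightarrow> real) \<Rightarrow> (real \<Rightarrow> real) \<Rightarrow> ereal \<Rightarrow> ereal \<Rightarrow>
     real \<Rightarrow> real \<Rightarrow> real \<Rightarrow> real \<Rightarrow> real \<Rightarrow> real \<Rightarrow> real" where
  "bprhm2_density F0 f0 a b \<theta>1 \<theta>2 \<theta>1' \<theta>2' y1 y2 =
     (if a < ereal y1 \<and> y1 < y2 \<and> ereal y2 < b then
        \<theta>1' * \<theta>2 * f0 y1 * f0 y2 * F0 y1 powr (\<theta>1' - 1) * F0 y2 powr (\<theta>1 + \<theta>2 - \<theta>1' - 1)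
      else if a < ereal y2 \<and> y2 < y1 \<and> ereal y1 < b then
        \<theta>1 * \<theta>2' * f0 y1 * f0 y2 * F0 y1 powr (\<theta>1 + \<theta>2 - \<theta>2' - 1) * F0 y2 powr (\<theta>2' - 1)
      else 0)"

definition has_BPRHM2 ::
    "'a measure \<Rightarrow> ('a \<Rightarrow> real) \<Rightarrow> ('a \<Rightarrow> real) \<Rightarrow>
     (real \<Rightarrow> real) \<Rightarrow> (real \<Rightarrow> real) \<Rightarrow> ereal \<Rightarrow> ereal \<Rightarrow>
     real \<Rightarrow> real \<Rightarrow> real \<Rightarrow> real \<Rightarrow> bool" where
  "has_BPRHM2 M Y1 Y2 F0 f0 a b \<theta>1 \<theta>2 \<theta>1' \<theta>2' \<longleftrightarrow>
     distributed M (lborel \<Otimes>\<^sub>M lborel) (\<lambda>\<omega>. (Y1 \<omega>, Y2 \<omega>))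
       (\<lambda>(y1, y2). ennreal (bprhm2_density F0 f0 a b \<theta>1 \<theta>2 \<theta>1' \<theta>2' y1 y2))"

text \<open>The prescribed marginal distribution function of one component, as a function of
  \<open>u = F0 y\<close>; \<open>s\<close> and \<open>s'\<close> are the parameters \<open>\<theta>\<^sub>i\<close> and \<open>\<theta>\<^sub>i'\<close> of that component and \<open>t\<close> is the
  parameter \<open>\<theta>\<^sub>3\<^sub>-\<^sub>i\<close> of the other one.\<close>

definition bprhm2_marginal :: "real \<Rightarrow> real \<Rightarrow> real \<Rightarrow> real \<Rightarrow> real" where
  "bprhm2_marginal s t s' u =
     (if s + t \<noteq> s' then
        t / (s + t - s') * u powr s' + (s - s') / (s + t - s') * u powr (s + t)
      else u powr (s + t) * (1 - t * ln u))"

end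

theory Submission
  imports Defs "HOL-Real_Asymp.Real_Asymp"
begin

text \<open>
  The homogeneity of \<open>G\<close> leaves no freedom: on each side of the diagonal \<open>F\<close> is a power of the
  larger of \<open>F0 y1\<close>, \<open>F0 y2\<close> times a marginal, evaluated where \<open>F0\<close> equals the quotient of the two.
  Hence \<open>F y1 y2 = H (F0 y1) (F0 y2)\<close> for an explicit function \<open>H\<close> of the parameters
  (\<open>bprhm2_cdf\<close>), and the second claim is this formula with the quotient written as \<open>F0\<close> of its own
  inverse image.

  For the first claim one must see that the BPRHM2 density has the joint distribution function
  \<open>H (F0 y1) (F0 y2)\<close> too; a probability measure on the plane is determined by its values on lower
  left quadrants (\<open>measure_eqI_lower_quadrants\<close>).  The density is \<open>f0 y1 * f0 y2\<close> times a function of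
  \<open>F0 y1\<close> and \<open>F0 y2\<close>.  The distribution \<open>D0\<close> is the image of the uniform distribution under the
  quantile function, so integrating against it turns \<open>F0 y\<close> into a uniform variable
  (\<open>nn_integral_quantile\<close>), and the quadrant becomes a box with corner \<open>(F0 y1, F0 y2)\<close> in the unit
  square.  There the density is a sum of two products of powers, one on each side of the diagonal, and
  its integral over the box is elementary (\<open>wedge_box_mass\<close>).  The box cuts off from one of the
  wedges only a triangle at the origin, and both triangles together have mass
  \<open>min p q powr (\<theta>1 + \<theta>2)\<close>; the rest of the other wedge accounts for the remaining term
  of the marginal (\<open>marginal_eq_masses\<close>).

  What remains are the points with \<open>F0 y1 = 0\<close> or \<open>F0 y2 = 0\<close>, on which the functional equation
  is silent.  The density vanishes on their quadrants.  The distribution of \<open>(Y1, Y2)\<close> gives them mass 0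
  as well, because the prescribed marginals tend to 0 at the lower end of the support and so have no
  atom there (\<open>cdf_eq_0_below_support\<close>).
\<close>

section \<open>The quantile function of the baseline distribution\<close>

text \<open>Below, \<open>C\<close> is the distribution function and \<open>I\<close> the generalized inverse
  \<open>I r = Inf {x. r \<le> C x}\<close>.  On the open unit interval it agrees with \<open>baseline_inv\<close>, which may
  be infinite at 0 and 1.\<close>

locale baseline = cdf_distribution D0 for D0 :: "real measure" +
  fixes f0 :: "real \<Rightarrow> real" and a b :: ereal
  assumes baseline: "baseline_distribution D0 f0 a b"
begin

lemma f0_nonneg: "0 \<le> f0 x"
  and f0_measurable [measurable]: "f0 \<in> borel_measurable borel"
  and D0_eq_density: "D0 = density lborel (\<lambda>x. ennreal (f0 x))"
  and AE_in_support: "AE x in D0. a \<le> ereal x \<and> ereal x \<le> b"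
  using baseline unfolding baseline_distribution_def by blast+

lemma singleton_null: "emeasure D0 {x} = 0"
proof -
  have "emeasure D0 {x} = (\<integral>\<^sup>+ y. ennreal (f0 y) * indicator {x} y \<partial>lborel)"
    by (subst D0_eq_density, subst emeasure_density) auto
  also have "\<dots> = (\<integral>\<^sup>+ y. 0 \<partial>(lborel :: real measure))"
    using AE_lborel_singleton[of x] by (intro nn_integral_cong_AE) auto
  finally show ?thesis by simp
qed

lemma isCont_cdf0: "isCont C x"
  by (simp add: isCont_cdf measure_def singleton_null)

lemma support_if_cdf_interior:
  assumes "0 < C y" "C y < 1"
  shows "a < ereal y" "ereal y < b"
proof -
  have null: "AE x in D0. x \<noteq> y"
    using singleton_null[of y] by (intro AE_I[of _ _ "{y}"]) auto
  show "a < ereal y"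
  proof (rule ccontr)
    assume "\<not> a < ereal y"
    have "AE x in D0. x \<notin> {..y}"
      using AE_in_support null
    proof eventually_elim
      case (elim x)
      with \<open>\<not> a < ereal y\<close> have "ereal y \<le> ereal x"
        by (meson not_less order_trans)
      with elim show ?case by simp
    qed
    then have "C y = 0"
      by (simp add: cdf_def prob_eq_0)
    with assms show False by simp
  qed
  show "ereal y < b"
  proof (rule ccontr)
    assume "\<not> ereal y < b"
    have "AE x in D0. x \<in> {..y}"
      using AE_in_support
    proof eventually_elim
      case (elim x)
      with \<open>\<not> ereal y < b\<close> have "ereal x \<le> ereal y"
        by (meson not_less order_trans)
      then show ?case by simp
    qed
    then have "C y = 1"
      by (simp add: cdf_def prob_eq_1)
    with assms show False by simp
  qed
qed

text \<open>A distribution function with jumps would only satisfy \<open>r \<le> C (I r)\<close>; here continuity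
  provides a point at which \<open>C\<close> equals \<open>r\<close>, and the quantile cannot exceed it.\<close>

lemma cdf_quantile:
  assumes "0 < r" "r < 1"
  shows "C (I r) = r"
proof (rule antisym)
  show "r \<le> C (I r)"
    using pseudoinverse[of r "I r"] assms by simp
  obtain l where l: "C l < r"
    using order_tendstoD(2)[OF bot \<open>0 < r\<close>] by (auto dest: eventually_happens)
  obtain h where h: "r < C h"
    using order_tendstoD(1)[OF top \<open>r < 1\<close>] by (auto dest: eventually_happens)
  have "l \<le> h"
    using l h monoD[OF mono, of h l] by linarith
  then obtain y where y: "C y = r"
    using IVT'[of C l r h] l h isCont_cdf0 by (auto intro!: continuous_at_imp_continuous_on)
  then have "I r \<le> y"
    using pseudoinverse[of r y] assms by simp
  with y show "C (I r) \<le> r"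
    using monoD[OF mono] by blast
qed

lemma quantile_in_support:
  assumes "0 < r" "r < 1"
  shows "a < ereal (I r)" "ereal (I r) < b"
  using support_if_cdf_interior[of "I r"] cdf_quantile[OF assms] assms by auto

lemma quantile_less_iff:
  assumes "0 < r" "r < 1" "0 < s" "s < 1"
  shows "I r < I s \<longleftrightarrow> r < s"
  using pseudoinverse[of s "I r"] cdf_quantile[of r] assms by (auto simp: not_le[symmetric])

lemma baseline_inv_quantile:
  assumes "0 < r" "r < 1"
  shows "baseline_inv D0 a b r = ereal (I r)"
proof -
  have "inj_on (ecdf D0) {a..b}"
    using baseline unfolding baseline_distribution_def by (blast intro: strict_mono_on_imp_inj_on)
  moreover have "ecdf D0 (ereal (I r)) = r"
    using assms by (simp add: ecdf_ereal cdf_quantile)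
  moreover have "ereal (I r) \<in> {a..b}"
    using quantile_in_support[OF assms] by (simp add: less_imp_le)
  ultimately show ?thesis
    unfolding baseline_inv_def by (metis the_inv_into_f_f)
qed

text \<open>Substituting \<open>r = C y\<close>.  As \<open>C\<close> may be neither differentiable everywhere nor injective off
  the support, the substitution is made through \<open>D0\<close> being the image of the uniform distribution
  under \<open>I\<close>.\<close>

lemma nn_integral_quantile:
  assumes [measurable]: "h \<in> borel_measurable borel"
  shows "(\<integral>\<^sup>+ y. ennreal (f0 y) * h y \<partial>lborel) = (\<integral>\<^sup>+ r. h (I r) * indicator {0<..<1} r \<partial>lborel)"
proof -
  have [measurable]: "I \<in> borel_measurable (restrict_space lborel {0<..<1::real})"
    using measurable_CI by (simp add: measurable_def space_restrict_space sets_restrict_space)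
  have "(\<integral>\<^sup>+ y. ennreal (f0 y) * h y \<partial>lborel) = (\<integral>\<^sup>+ y. h y \<partial>density lborel (\<lambda>y. ennreal (f0 y)))"
    by (subst nn_integral_density) auto
  also have "\<dots> = (\<integral>\<^sup>+ y. h y \<partial>D0)"
    by (simp only: D0_eq_density[symmetric])
  also have "\<dots> = (\<integral>\<^sup>+ y. h y \<partial>distr (restrict_space lborel {0<..<1::real}) borel I)"
    by (simp only: distr_I_eq_M)
  also have "\<dots> = (\<integral>\<^sup>+ r. h (I r) \<partial>restrict_space lborel {0<..<1::real})"
    by (rule nn_integral_distr) auto
  also have "\<dots> = (\<integral>\<^sup>+ r. h (I r) * indicator {0<..<1} r \<partial>lborel)"
    by (rule nn_integral_restrict_space) auto
  finally show ?thesis .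
qed

end

section \<open>Masses of boxes in the unit square\<close>

lemma bprhm2_density_baseline:
  "bprhm2_density F0 f0 a b \<theta>1 \<theta>2 \<theta>1' \<theta>2' y1 y2 =
     f0 y1 * f0 y2 * bprhm2_density F0 (\<lambda>_. 1) a b \<theta>1 \<theta>2 \<theta>1' \<theta>2' y1 y2"
  by (simp add: bprhm2_density_def)

text \<open>One half of the BPRHM2 density for the uniform baseline, with \<open>d\<close> in place of
  \<open>\<theta>1 + \<theta>2 - c\<close>.  The other half is of the same form with its arguments exchanged, so that
  one calculation serves for both.\<close>

definition wedge :: "real \<Rightarrow> real \<Rightarrow> real \<Rightarrow> real \<Rightarrow> real \<Rightarrow> real" where
  "wedge t c d u v =
     (if 0 < u \<and> u < v \<and> v < 1 then c * t * u powr (c - 1) * v powr (d - 1) else 0)"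

lemma wedge_measurable [measurable]:
  assumes [measurable]: "f \<in> borel_measurable N" "g \<in> borel_measurable N"
  shows "(\<lambda>x. wedge t c d (f x) (g x)) \<in> borel_measurable N"
  unfolding wedge_def by measurable

text \<open>The integral of \<open>x powr (d - 1)\<close> from \<open>p\<close> to \<open>q\<close>, for \<open>0 < p \<le> q\<close>.  Its logarithmic case is the origin of the
  logarithm in the marginals when \<open>\<theta>1 + \<theta>2\<close> equals \<open>\<theta>i'\<close>.\<close>

definition powr_int :: "real \<Rightarrow> real \<Rightarrow> real \<Rightarrow> real" where
  "powr_int d p q = (if d = 0 then ln q - ln p else (q powr d - p powr d) / d)"

lemma powr_int_refl: "powr_int d p p = 0"
  by (simp add: powr_int_def)

lemma has_integral_powr_int:
  assumes "0 < p" "p \<le> q"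
  shows "((\<lambda>x. x powr (d - 1)) has_integral powr_int d p q) {p..q}"
proof (cases "d = 0")
  case True
  have "((\<lambda>x. x powr (- 1)) has_integral ln q - ln p) {p..q}"
    using assms
    by (intro fundamental_theorem_of_calculus)
       (auto intro!: derivative_eq_intros simp: has_real_derivative_iff_has_vector_derivative[symmetric]
          powr_minus field_simps)
  with True show ?thesis by (simp add: powr_int_def)
next
  case False
  have "((\<lambda>x. x powr (d - 1)) has_integral q powr d / d - p powr d / d) {p..q}"
    using assms False
    by (intro fundamental_theorem_of_calculus)
       (auto intro!: derivative_eq_intros simp: has_real_derivative_iff_has_vector_derivative[symmetric])
  with False show ?thesis by (simp add: powr_int_def diff_divide_distrib)
qed

lemma wedge_section_mass:
  assumes "0 < c" "0 \<le> t" "0 < p" "0 < v" "v < 1"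
  shows "(\<integral>\<^sup>+ u. ennreal (wedge t c d u v) * indicator {..p} u \<partial>lborel) =
    ennreal (t * (v powr (d - 1) * min p v powr c))"
proof -
  let ?m = "min p v"
  have "((\<lambda>u. u powr (c - 1)) has_integral ?m powr c / c) {0..?m}"
    using has_integral_powr_from_0[of "c - 1" ?m] assms by simp
  from has_integral_mult_right[OF this, of "c * t * v powr (d - 1)"]
  have "((\<lambda>u. c * t * v powr (d - 1) * u powr (c - 1)) has_integral t * (v powr (d - 1) * ?m powr c)) {0..?m}"
    using assms by (simp add: field_simps)
  from nn_integral_has_integral_lebesgue'[OF _ this]
  have "(\<integral>\<^sup>+ u. ennreal (c * t * v powr (d - 1) * u powr (c - 1)) * indicator {0..?m} u \<partial>lborel) =
      ennreal (t * (v powr (d - 1) * ?m powr c))"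
    using assms by simp
  moreover have "(\<integral>\<^sup>+ u. ennreal (wedge t c d u v) * indicator {..p} u \<partial>lborel) =
      (\<integral>\<^sup>+ u. ennreal (c * t * v powr (d - 1) * u powr (c - 1)) * indicator {0..?m} u \<partial>lborel)"
  proof (intro nn_integral_cong_AE)
    show "AE u in lborel. ennreal (wedge t c d u v) * indicator {..p} u =
        ennreal (c * t * v powr (d - 1) * u powr (c - 1)) * indicator {0..?m} u"
      using AE_lborel_singleton[of 0] AE_lborel_singleton[of v]
      by eventually_elim (use assms in \<open>auto simp: wedge_def indicator_def mult_ac\<close>)
  qed
  ultimately show ?thesis by simp
qed

text \<open>Integrating out \<open>u\<close> leaves \<open>t * v powr (d - 1) * min p v powr c\<close>.  Up to \<open>min p q\<close> this is
  \<open>t * v powr (c + d - 1)\<close>, whose integral is the mass of a triangle at the origin; from there to \<open>q\<close>, present only if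
  \<open>p < q\<close>, \<open>min p v powr c\<close> is the constant \<open>p powr c\<close>.\<close>

lemma wedge_box_mass:
  assumes "0 < c" "0 < c + d" "0 \<le> t" "0 < p" "0 < q" "q \<le> 1"
  shows "(\<integral>\<^sup>+ v. (\<integral>\<^sup>+ u. ennreal (wedge t c d u v) * indicator {..p} u \<partial>lborel) * indicator {..q} v \<partial>lborel) =
    ennreal (t * (min p q powr (c + d) / (c + d) + p powr c * powr_int d (min p q) q))"
proof -
  let ?h = "\<lambda>v. v powr (d - 1) * min p v powr c" and ?m = "min p q"
  let ?J = "?m powr (c + d) / (c + d) + p powr c * powr_int d ?m q"
  \<comment> \<open>The triangle at the origin.\<close>
  have 1: "(?h has_integral ?m powr (c + d) / (c + d)) {0..?m}"
  proof (rule has_integral_eq)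
    show "((\<lambda>v. v powr (c + d - 1)) has_integral ?m powr (c + d) / (c + d)) {0..?m}"
      using has_integral_powr_from_0[of "c + d - 1" ?m] assms by simp
    show "v powr (c + d - 1) = ?h v" if "v \<in> {0..?m}" for v
      using that by (simp add: powr_add[symmetric] min_absorb2 algebra_simps)
  qed
  \<comment> \<open>The strip beyond the triangle; it is void unless \<open>p < q\<close>.\<close>
  have 2: "(?h has_integral p powr c * powr_int d ?m q) {?m..q}"
  proof (cases "p \<le> q")
    case True
    show ?thesis
    proof (rule has_integral_eq)
      show "((\<lambda>v. p powr c * v powr (d - 1)) has_integral p powr c * powr_int d ?m q) {?m..q}"
        using assms by (intro has_integral_mult_right has_integral_powr_int) auto
      show "p powr c * v powr (d - 1) = ?h v" if "v \<in> {?m..q}" for v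
        using that True by simp
    qed
  next
    case False
    then show ?thesis
      by (simp add: powr_int_def min_absorb2 has_integral_refl)
  qed
  have "(?h has_integral ?J) {0..q}"
    by (rule has_integral_combine[OF _ _ 1 2]) (use assms in auto)
  then have "((\<lambda>v. t * ?h v) has_integral t * ?J) {0..q}"
    by (rule has_integral_mult_right)
  from nn_integral_has_integral_lebesgue'[OF _ this]
  have "(\<integral>\<^sup>+ v. ennreal (t * ?h v) * indicator {0..q} v \<partial>lborel) = ennreal (t * ?J)"
    using assms by simp
  moreover have "(\<integral>\<^sup>+ v. (\<integral>\<^sup>+ u. ennreal (wedge t c d u v) * indicator {..p} u \<partial>lborel) * indicator {..q} v \<partial>lborel) =
      (\<integral>\<^sup>+ v. ennreal (t * ?h v) * indicator {0..q} v \<partial>lborel)"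
  proof (intro nn_integral_cong_AE)
    show "AE v in lborel. (\<integral>\<^sup>+ u. ennreal (wedge t c d u v) * indicator {..p} u \<partial>lborel) * indicator {..q} v =
      ennreal (t * ?h v) * indicator {0..q} v"
      using AE_lborel_singleton[of 0] AE_lborel_singleton[of 1]
    proof eventually_elim
      case (elim v)
      show ?case
      proof (cases "0 < v \<and> v \<le> q")
        case True
        then show ?thesis
          using wedge_section_mass[of c t p v d] assms elim by simp
      next
        case False
        then have "wedge t c d u v * indicator {..q} v = 0" for u
          by (auto simp: wedge_def indicator_def)
        with False elim show ?thesis
          by (auto simp: indicator_def wedge_def)
      qed
    qed
  qed
  ultimately show ?thesis by simp
qed

lemma bprhm2_density_uniform:
  "bprhm2_density (\<lambda>u. u) (\<lambda>_. 1) 0 1 \<theta>1 \<theta>2 \<theta>1' \<theta>2' u v =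
     wedge \<theta>2 \<theta>1' (\<theta>1 + \<theta>2 - \<theta>1') u v + wedge \<theta>1 \<theta>2' (\<theta>1 + \<theta>2 - \<theta>2') v u"
  by (auto simp: bprhm2_density_def wedge_def mult_ac zero_ereal_def one_ereal_def)

text \<open>The prescribed marginal in the form in which it comes out of the integration: the
  triangles of the two wedges, and then the strip.\<close>

lemma marginal_eq_masses:
  assumes "0 < p" "p \<le> q" "0 < s" "0 < t" "0 < s'"
  shows "q powr (s + t) * bprhm2_marginal s t s' (p / q) =
     p powr (s + t) + t * (p powr s' * powr_int (s + t - s') p q)"
proof (cases "s + t = s'")
  case True
  then show ?thesis using assms
    by (simp add: bprhm2_marginal_def powr_int_def powr_divide ln_div field_simps)
next
  case False
  then have d: "s + t - s' \<noteq> 0" by simp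
  have "q powr (s + t) * bprhm2_marginal s t s' (p / q) =
     (t * (p powr s' * q powr (s + t - s')) + (s - s') * p powr (s + t)) / (s + t - s')"
    using assms False by (simp add: bprhm2_marginal_def powr_divide powr_diff add_divide_distrib distrib_left mult_ac)
  also have "\<dots> = (t * (p powr s' * q powr (s + t - s')) + (s + t - s') * p powr (s + t) - t * (p powr s' * p powr (s + t - s'))) / (s + t - s')"
    by (simp add: powr_add[symmetric] algebra_simps)
  also have "\<dots> = p powr (s + t) + t * (p powr s' * powr_int (s + t - s') p q)"
    using d False by (simp add: powr_int_def field_simps)
  finally show ?thesis .
qed

lemma bprhm2_marginal_1: "0 < s' \<Longrightarrow> bprhm2_marginal s t s' 1 = 1"
  by (simp add: bprhm2_marginal_def add_divide_distrib[symmetric])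

lemma bprhm2_marginal_tendsto_0:
  assumes "0 < s" "0 < t" "0 < s'"
  shows "(bprhm2_marginal s t s' \<longlongrightarrow> 0) (at_right 0)"
proof (cases "s + t = s'")
  case True
  have "((\<lambda>u. u powr s' * (1 - t * ln u)) \<longlongrightarrow> 0) (at_right 0)"
    using assms by real_asymp
  with True show ?thesis by (simp add: bprhm2_marginal_def[abs_def])
next
  case False
  have "((\<lambda>u. t / (s + t - s') * u powr s' + (s - s') / (s + t - s') * u powr (s + t)) \<longlongrightarrow>
      t / (s + t - s') * 0 + (s - s') / (s + t - s') * 0) (at_right 0)"
    using assms by (intro tendsto_intros) real_asymp+
  with False show ?thesis by (simp add: bprhm2_marginal_def[abs_def])
qed


text \<open>The joint distribution function of BPRHM2 with uniform baseline, at \<open>p\<close> and \<open>q\<close> up to 1.\<close>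

definition bprhm2_cdf :: "real \<Rightarrow> real \<Rightarrow> real \<Rightarrow> real \<Rightarrow> real \<Rightarrow> real \<Rightarrow> real" where
  "bprhm2_cdf \<theta>1 \<theta>2 \<theta>1' \<theta>2' p q =
     (if p \<le> 0 \<or> q \<le> 0 then 0
      else if q \<le> p then p powr (\<theta>1 + \<theta>2) * bprhm2_marginal \<theta>2 \<theta>1 \<theta>2' (q / p)
      else q powr (\<theta>1 + \<theta>2) * bprhm2_marginal \<theta>1 \<theta>2 \<theta>1' (p / q))"

text \<open>One of the two strips is void.  The triangles carry \<open>min p q powr (\<theta>1 + \<theta>2)\<close> in the
  proportion \<open>\<theta>2\<close> to \<open>\<theta>1\<close>, and with the other strip this is the marginal.\<close>

lemma sum_wedge_masses:
  assumes "0 < \<theta>1" "0 < \<theta>2" "0 < \<theta>1'" "0 < \<theta>2'" "0 < p" "0 < q"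
  shows "\<theta>2 * (min p q powr (\<theta>1 + \<theta>2) / (\<theta>1 + \<theta>2) + p powr \<theta>1' * powr_int (\<theta>1 + \<theta>2 - \<theta>1') (min p q) q)
    + \<theta>1 * (min q p powr (\<theta>1 + \<theta>2) / (\<theta>1 + \<theta>2) + q powr \<theta>2' * powr_int (\<theta>1 + \<theta>2 - \<theta>2') (min q p) p)
    = bprhm2_cdf \<theta>1 \<theta>2 \<theta>1' \<theta>2' p q"
proof -
  have split: "\<theta>2 * (x / (\<theta>1 + \<theta>2)) + \<theta>1 * (x / (\<theta>1 + \<theta>2)) = x" for x
    using assms by (simp add: add_divide_distrib[symmetric] distrib_right[symmetric] add.commute)
  show ?thesis
  proof (cases "q \<le> p")
    case True
    with split[of "q powr (\<theta>1 + \<theta>2)"] marginal_eq_masses[of q p \<theta>2 \<theta>1 \<theta>2'] assms show ?thesis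
      by (simp add: bprhm2_cdf_def min_absorb1 min_absorb2 powr_int_refl add.commute[of \<theta>2] distrib_left)
  next
    case False
    with split[of "p powr (\<theta>1 + \<theta>2)"] marginal_eq_masses[of p q \<theta>1 \<theta>2 \<theta>1'] assms show ?thesis
      by (simp add: bprhm2_cdf_def min_absorb1 min_absorb2 powr_int_refl distrib_left)
  qed
qed

lemma bprhm2_uniform_box_mass:
  assumes "0 < \<theta>1" "0 < \<theta>2" "0 < \<theta>1'" "0 < \<theta>2'" "0 < p" "p \<le> 1" "0 < q" "q \<le> 1"
  shows "(\<integral>\<^sup>+ u. (\<integral>\<^sup>+ v. ennreal (bprhm2_density (\<lambda>u. u) (\<lambda>_. 1) 0 1 \<theta>1 \<theta>2 \<theta>1' \<theta>2' u v)
      * indicator {..q} v \<partial>lborel) * indicator {..p} u \<partial>lborel) = ennreal (bprhm2_cdf \<theta>1 \<theta>2 \<theta>1' \<theta>2' p q)"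
proof -
  let ?d1 = "\<theta>1 + \<theta>2 - \<theta>1'" and ?d2 = "\<theta>1 + \<theta>2 - \<theta>2'"
  let ?W1 = "\<lambda>u v. ennreal (wedge \<theta>2 \<theta>1' ?d1 u v)" and ?W2 = "\<lambda>u v. ennreal (wedge \<theta>1 \<theta>2' ?d2 v u)"
  have nonneg: "0 \<le> wedge \<theta>2 \<theta>1' ?d1 u v" "0 \<le> wedge \<theta>1 \<theta>2' ?d2 v u" for u v
    using assms by (auto simp: wedge_def)
  have J: "0 \<le> powr_int d (min x y) y" if "0 < x" "0 < y" for d x y :: real
    using has_integral_nonneg[OF has_integral_powr_int[of "min x y" y d]] that by simp
  have "(\<integral>\<^sup>+ u. (\<integral>\<^sup>+ v. ennreal (bprhm2_density (\<lambda>u. u) (\<lambda>_. 1) 0 1 \<theta>1 \<theta>2 \<theta>1' \<theta>2' u v)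
      * indicator {..q} v \<partial>lborel) * indicator {..p} u \<partial>lborel) =
    (\<integral>\<^sup>+ u. (\<integral>\<^sup>+ v. ?W1 u v * indicator {..q} v \<partial>lborel) * indicator {..p} u
       + (\<integral>\<^sup>+ v. ?W2 u v * indicator {..q} v \<partial>lborel) * indicator {..p} u \<partial>lborel)"
    by (simp add: bprhm2_density_uniform ennreal_plus nonneg distrib_right nn_integral_add)
  also have "\<dots> = (\<integral>\<^sup>+ u. (\<integral>\<^sup>+ v. ?W1 u v * indicator {..q} v \<partial>lborel) * indicator {..p} u \<partial>lborel)
       + (\<integral>\<^sup>+ u. (\<integral>\<^sup>+ v. ?W2 u v * indicator {..q} v \<partial>lborel) * indicator {..p} u \<partial>lborel)"
    by (rule nn_integral_add) measurable
  also have "(\<integral>\<^sup>+ u. (\<integral>\<^sup>+ v. ?W1 u v * indicator {..q} v \<partial>lborel) * indicator {..p} u \<partial>lborel) =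
      (\<integral>\<^sup>+ u. (\<integral>\<^sup>+ v. ?W1 u v * indicator {..q} v * indicator {..p} u \<partial>lborel) \<partial>lborel)"
    by (simp add: nn_integral_multc)
  \<comment> \<open>The smaller coordinate must be integrated out first, which is \<open>u\<close> in the wedge \<open>?W1\<close>.\<close>
  also have "\<dots> = (\<integral>\<^sup>+ v. (\<integral>\<^sup>+ u. ?W1 u v * indicator {..q} v * indicator {..p} u \<partial>lborel) \<partial>lborel)"
    by (rule lborel_pair.Fubini') measurable
  also have "\<dots> = (\<integral>\<^sup>+ v. (\<integral>\<^sup>+ u. ?W1 u v * indicator {..p} u \<partial>lborel) * indicator {..q} v \<partial>lborel)"
    by (subst nn_integral_multc[symmetric]) (auto simp: mult_ac)
  finally show ?thesis
    using assms J[of p q ?d1] J[of q p ?d2]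
    by (simp add: wedge_box_mass ennreal_plus[symmetric] sum_wedge_masses del: ennreal_plus)
qed

section \<open>The joint distribution function of the BPRHM2 density\<close>

context baseline
begin

lemma bprhm2_density_quantile:
  assumes "0 < u" "u < 1" "0 < v" "v < 1"
  shows "bprhm2_density C (\<lambda>_. 1) a b \<theta>1 \<theta>2 \<theta>1' \<theta>2' (I u) (I v) =
     bprhm2_density (\<lambda>u. u) (\<lambda>_. 1) 0 1 \<theta>1 \<theta>2 \<theta>1' \<theta>2' u v"
  using assms quantile_in_support[of u] quantile_in_support[of v]
  by (simp add: bprhm2_density_def cdf_quantile quantile_less_iff zero_ereal_def one_ereal_def)

lemma bprhm2_density_measurable [measurable]:
  assumes [measurable]: "X \<in> borel_measurable N" "Y \<in> borel_measurable N" "g \<in> borel_measurable borel"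
  shows "(\<lambda>x. bprhm2_density C g a b \<theta>1 \<theta>2 \<theta>1' \<theta>2' (X x) (Y x)) \<in> borel_measurable N"
  unfolding bprhm2_density_def by measurable

text \<open>Because \<open>I u \<le> x\<close> is equivalent to \<open>u \<le> C x\<close> for \<open>u\<close> between 0 and 1, the quadrant turns into a box exactly
  and not merely up to null sets.\<close>

lemma emeasure_bprhm2_box:
  assumes "0 < \<theta>1" "0 < \<theta>2" "0 < \<theta>1'" "0 < \<theta>2'"
  shows "emeasure (density (lborel \<Otimes>\<^sub>M lborel)
      (\<lambda>(y1, y2). ennreal (bprhm2_density C f0 a b \<theta>1 \<theta>2 \<theta>1' \<theta>2' y1 y2))) ({..x} \<times> {..y}) =
    ennreal (bprhm2_cdf \<theta>1 \<theta>2 \<theta>1' \<theta>2' (C x) (C y))"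
proof -
  let ?h = "bprhm2_density C (\<lambda>_. 1) a b \<theta>1 \<theta>2 \<theta>1' \<theta>2'"
  let ?g = "bprhm2_density (\<lambda>u. u) (\<lambda>_. 1) 0 1 \<theta>1 \<theta>2 \<theta>1' \<theta>2'"
  have split: "ennreal (bprhm2_density C f0 a b \<theta>1 \<theta>2 \<theta>1' \<theta>2' y1 y2) =
      ennreal (f0 y1) * (ennreal (f0 y2) * ennreal (?h y1 y2))" for y1 y2
    by (subst bprhm2_density_baseline) (simp add: ennreal_mult' f0_nonneg mult.assoc)
  have inner: "(\<integral>\<^sup>+ y2. ennreal (f0 y2) * (ennreal (?h (I u) y2) * indicator {..y} y2) \<partial>lborel) =
      (\<integral>\<^sup>+ v. ennreal (?h (I u) (I v)) * indicator {..y} (I v) * indicator {0<..<1} v \<partial>lborel)" for u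
    by (rule nn_integral_quantile) measurable
  have "emeasure (density (lborel \<Otimes>\<^sub>M lborel)
      (\<lambda>(y1, y2). ennreal (bprhm2_density C f0 a b \<theta>1 \<theta>2 \<theta>1' \<theta>2' y1 y2))) ({..x} \<times> {..y}) =
    (\<integral>\<^sup>+ y1. (\<integral>\<^sup>+ y2. ennreal (bprhm2_density C f0 a b \<theta>1 \<theta>2 \<theta>1' \<theta>2' y1 y2)
       * indicator ({..x} \<times> {..y}) (y1, y2) \<partial>lborel) \<partial>lborel)"
    by (subst emeasure_density) (auto simp: case_prod_beta' lborel.nn_integral_fst[symmetric])
  also have "\<dots> = (\<integral>\<^sup>+ y1. ennreal (f0 y1) * (indicator {..x} y1 *
      (\<integral>\<^sup>+ y2. ennreal (f0 y2) * (ennreal (?h y1 y2) * indicator {..y} y2) \<partial>lborel)) \<partial>lborel)"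
    by (simp add: split indicator_times mult_ac nn_integral_cmult[symmetric])
  also have "\<dots> = (\<integral>\<^sup>+ u. indicator {..x} (I u) *
      (\<integral>\<^sup>+ y2. ennreal (f0 y2) * (ennreal (?h (I u) y2) * indicator {..y} y2) \<partial>lborel)
        * indicator {0<..<1} u \<partial>lborel)"
    by (rule nn_integral_quantile) measurable
  also have "\<dots> = (\<integral>\<^sup>+ u. indicator {..x} (I u) *
      (\<integral>\<^sup>+ v. ennreal (?h (I u) (I v)) * indicator {..y} (I v) * indicator {0<..<1} v \<partial>lborel)
        * indicator {0<..<1} u \<partial>lborel)"
    by (simp only: inner)
  also have "\<dots> = (\<integral>\<^sup>+ u. (\<integral>\<^sup>+ v. ennreal (?g u v) * indicator {..C y} v \<partial>lborel)
        * indicator {..C x} u \<partial>lborel)"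
  proof (rule nn_integral_cong)
    fix u :: real
    show "indicator {..x} (I u) *
      (\<integral>\<^sup>+ v. ennreal (?h (I u) (I v)) * indicator {..y} (I v) * indicator {0<..<1} v \<partial>lborel)
        * indicator {0<..<1} u = (\<integral>\<^sup>+ v. ennreal (?g u v) * indicator {..C y} v \<partial>lborel)
        * indicator {..C x} u"
    proof (cases "0 < u \<and> u < 1")
      case True
      have "(\<integral>\<^sup>+ v. ennreal (?h (I u) (I v)) * indicator {..y} (I v) * indicator {0<..<1} v \<partial>lborel) =
          (\<integral>\<^sup>+ v. ennreal (?g u v) * indicator {..C y} v \<partial>lborel)"
      proof (rule nn_integral_cong)
        fix v :: real
        show "ennreal (?h (I u) (I v)) * indicator {..y} (I v) * indicator {0<..<1} v =
            ennreal (?g u v) * indicator {..C y} v"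
        proof (cases "0 < v \<and> v < 1")
          case True
          with \<open>0 < u \<and> u < 1\<close> show ?thesis
            by (simp add: bprhm2_density_quantile indicator_def pseudoinverse[symmetric])
        next
          case False
          then show ?thesis
            by (auto simp: bprhm2_density_uniform wedge_def)
        qed
      qed
      with True show ?thesis
        by (simp add: indicator_def pseudoinverse[symmetric])
    next
      case False
      then have "?g u v = 0" for v
        by (auto simp: bprhm2_density_uniform wedge_def)
      with False show ?thesis by simp
    qed
  qed
  also have "\<dots> = ennreal (bprhm2_cdf \<theta>1 \<theta>2 \<theta>1' \<theta>2' (C x) (C y))"
  proof (cases "0 < C x \<and> 0 < C y")
    case True
    then show ?thesis
      using assms by (simp add: bprhm2_uniform_box_mass cdf_bounded_prob)
  next
    case False
    then have zero: "ennreal (?g u v) * indicator {..C y} v * indicator {..C x} u = 0" for u v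
      by (auto simp: bprhm2_density_uniform wedge_def indicator_def)
    have "(\<integral>\<^sup>+ v. ennreal (?g u v) * indicator {..C y} v \<partial>lborel) * indicator {..C x} u = 0" for u
    proof -
      have "(\<integral>\<^sup>+ v. ennreal (?g u v) * indicator {..C y} v \<partial>lborel) * indicator {..C x} u =
          (\<integral>\<^sup>+ v. ennreal (?g u v) * indicator {..C y} v * indicator {..C x} u \<partial>lborel)"
        by (simp add: nn_integral_multc bprhm2_density_uniform)
      also have "\<dots> = 0"
        by (simp only: zero) simp
      finally show ?thesis .
    qed
    moreover have "bprhm2_cdf \<theta>1 \<theta>2 \<theta>1' \<theta>2' (C x) (C y) = 0"
      using False by (auto simp: bprhm2_cdf_def)
    ultimately show ?thesis
      by (simp only:) simp
  qed
  finally show ?thesis .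
qed

end

section \<open>Identification of the distribution\<close>

lemma measure_eqI_lower_quadrants:
  fixes M N :: "(real \<times> real) measure"
  assumes "finite_measure M"
    and sets: "sets M = sets borel" "sets N = sets borel"
    and eq: "\<And>x y. emeasure M ({..x} \<times> {..y}) = emeasure N ({..x} \<times> {..y})"
  shows "M = N"
proof -
  interpret finite_measure M by fact
  have atMost_pair: "{..p} = {..fst p} \<times> {..snd p}" for p :: "real \<times> real"
    by (auto simp: less_eq_prod_def)
  show ?thesis
  proof (rule measure_eqI_generator_eq)
    have "{..p} \<inter> {..q} = {..inf p q}" for p q :: "real \<times> real"
      by auto
    then show "Int_stable (range (\<lambda>p::real \<times> real. {..p}))"
      by (simp only: Int_stable_def) blast
    show "emeasure M X = emeasure N X" if "X \<in> range (\<lambda>p. {..p})" for X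
      using that eq by (auto simp: atMost_pair)
    show "sets M = sigma_sets UNIV (range atMost)" "sets N = sigma_sets UNIV (range atMost)"
      by (simp_all add: sets borel_eq_atMost)
    show "range (\<lambda>n. {..(real n, real n)}) \<subseteq> range atMost" by auto
    show "(\<Union>n. {..(real n, real n)}) = UNIV"
    proof (intro equalityI subsetI)
      fix p :: "real \<times> real"
      obtain n where "max (fst p) (snd p) \<le> real n"
        using real_arch_simple by blast
      then show "p \<in> (\<Union>n. {..(real n, real n)})"
        by (auto simp: atMost_pair mem_Times_iff)
    qed simp
  qed auto
qed


text \<open>A marginal given on the interior of the support alone might still have mass at the lower end
  point or below it.  An \<open>x\<close> with \<open>C x \<le> 0\<close> lies below all quantiles \<open>I r\<close>, hence \<open>cdf N x \<le> m r\<close>, and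
  the limit of \<open>m\<close> excludes this.\<close>

lemma (in baseline) cdf_eq_0_below_support:
  assumes "real_distribution N"
    and m: "\<And>r. 0 < r \<Longrightarrow> r < 1 \<Longrightarrow> cdf N (I r) = m r"
    and lim: "(m \<longlongrightarrow> 0) (at_right 0)" and "C x \<le> 0"
  shows "cdf N x = 0"
proof (rule antisym)
  interpret N: real_distribution N by fact
  show "0 \<le> cdf N x" by (rule N.cdf_nonneg)
  have "cdf N x \<le> m r" if "0 < r" "r < 1" for r
  proof -
    have "x \<le> I r"
      using pseudoinverse[of r x] that \<open>C x \<le> 0\<close> by simp
    then show ?thesis
      using N.cdf_nondecreasing m[OF that] by fastforce
  qed
  then have "eventually (\<lambda>r. cdf N x \<le> m r) (at_right 0)"
    unfolding eventually_at_right_field by (intro exI[of _ 1]) auto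
  from tendsto_lowerbound[OF lim this] show "cdf N x \<le> 0" by simp
qed

text \<open>At \<open>r = 1\<close> the inverse is \<open>b\<close>, which may be infinite, and the value 1 there comes from
  the support of \<open>N\<close>.\<close>

lemma (in baseline) ecdf_baseline_inv:
  assumes "real_distribution N" and le_b: "AE x in N. ereal x \<le> b"
    and m: "\<And>r. 0 < r \<Longrightarrow> r < 1 \<Longrightarrow> cdf N (I r) = m r" and "m 1 = 1" "0 < r" "r \<le> 1"
  shows "ecdf N (baseline_inv D0 a b r) = m r"
proof (cases "r = 1")
  case True
  interpret N: real_distribution N by fact
  have "measure N {x \<in> space N. ereal x \<le> b} = 1"
    using le_b by (subst N.prob_Collect_eq_1) auto
  with True baseline_inv_1[OF baseline] \<open>m 1 = 1\<close> show ?thesis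
    by (simp add: ecdf_def)
next
  case False
  interpret N: real_distribution N by fact
  from False assms show ?thesis
    by (simp add: baseline_inv_quantile ecdf_ereal)
qed

theorem corollary2p2:
  fixes M :: "'a measure" and Y1 Y2 :: "'a \<Rightarrow> real"
    and D0 :: "real measure" and f0 F0 :: "real \<Rightarrow> real" and a b :: ereal
    and F :: "real \<Rightarrow> real \<Rightarrow> real" and G :: "real \<Rightarrow> real \<Rightarrow> real"
    and \<theta>1 \<theta>2 \<theta>1' \<theta>2' \<theta> :: real
  assumes "\<theta>1 > 0" "\<theta>2 > 0" "\<theta>1' > 0" "\<theta>2' > 0" and "\<theta> = \<theta>1 + \<theta>2"
    and "baseline_distribution D0 f0 a b" and "F0 = cdf D0"
    and "prob_space M" and "Y1 \<in> borel_measurable M" and "Y2 \<in> borel_measurable M"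
    and "AE \<omega> in M. a \<le> ereal (Y1 \<omega>) \<and> ereal (Y1 \<omega>) \<le> b \<and> a \<le> ereal (Y2 \<omega>) \<and> ereal (Y2 \<omega>) \<le> b"
    and "F = joint_cdf M Y1 Y2"
    and "\<And>y1 y2. F0 y1 > 0 \<Longrightarrow> F0 y2 > 0 \<Longrightarrow> F y1 y2 = G (F0 y1) (F0 y2)"
    and "\<And>y1 y2. F0 y1 > 0 \<Longrightarrow> F0 y2 > 0 \<Longrightarrow> y1 \<ge> y2 \<Longrightarrow>
           G (F0 y1) (F0 y2) = F0 y1 powr \<theta> * G 1 (F0 y2 / F0 y1)"
    and "\<And>y1 y2. F0 y1 > 0 \<Longrightarrow> F0 y2 > 0 \<Longrightarrow> y1 \<le> y2 \<Longrightarrow>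
           G (F0 y1) (F0 y2) = F0 y2 powr \<theta> * G (F0 y1 / F0 y2) 1"
    and "\<And>y1. F0 y1 > 0 \<Longrightarrow> G (F0 y1) 1 = cdf (distr M borel Y1) y1"
    and "\<And>y2. F0 y2 > 0 \<Longrightarrow> G 1 (F0 y2) = cdf (distr M borel Y2) y2"
    and "G 1 1 = 1"
    and "\<And>y1. a < ereal y1 \<Longrightarrow> ereal y1 < b \<Longrightarrow>
           cdf (distr M borel Y1) y1 = bprhm2_marginal \<theta>1 \<theta>2 \<theta>1' (F0 y1)"
    and "\<And>y2. a < ereal y2 \<Longrightarrow> ereal y2 < b \<Longrightarrow>
           cdf (distr M borel Y2) y2 = bprhm2_marginal \<theta>2 \<theta>1 \<theta>2' (F0 y2)"
  shows "has_BPRHM2 M Y1 Y2 F0 f0 a b \<theta>1 \<theta>2 \<theta>1' \<theta>2' \<and>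
    (\<forall>y1 y2. F0 y1 > 0 \<longrightarrow> F0 y2 > 0 \<longrightarrow>
       (y1 \<ge> y2 \<longrightarrow> F y1 y2 = F0 y1 powr (\<theta>1 + \<theta>2) *
          ecdf (distr M borel Y2) (baseline_inv D0 a b (F0 y2 / F0 y1))) \<and>
       (y1 \<le> y2 \<longrightarrow> F y1 y2 = F0 y2 powr (\<theta>1 + \<theta>2) *
          ecdf (distr M borel Y1) (baseline_inv D0 a b (F0 y1 / F0 y2))))"
proof -
  note pos = assms(1-4)
  interpret baseline D0 f0 a b
  proof (intro baseline.intro cdf_distribution.intro real_distribution.intro
      baseline_axioms.intro real_distribution_axioms.intro)
    show "baseline_distribution D0 f0 a b" by fact
    then show "prob_space D0"
      unfolding baseline_distribution_def by blast
    have "D0 = density lborel (\<lambda>x. ennreal (f0 x))"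
      using \<open>baseline_distribution D0 f0 a b\<close> unfolding baseline_distribution_def by blast
    then show "sets D0 = sets borel"
      by (metis sets_density sets_lborel)
  qed
  interpret M: prob_space M by fact
  have [measurable]: "Y1 \<in> borel_measurable M" "Y2 \<in> borel_measurable M" by fact+
  let ?N1 = "distr M borel Y1" and ?N2 = "distr M borel Y2"
  let ?m1 = "bprhm2_marginal \<theta>1 \<theta>2 \<theta>1'" and ?m2 = "bprhm2_marginal \<theta>2 \<theta>1 \<theta>2'"
  interpret N1: real_distribution ?N1 by (rule M.real_distribution_distr) fact
  interpret N2: real_distribution ?N2 by (rule M.real_distribution_distr) fact
  have F0: "F0 = C" by fact
  have N1_quantile: "cdf ?N1 (I r) = ?m1 r" and N2_quantile: "cdf ?N2 (I r) = ?m2 r"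
    if "0 < r" "r < 1" for r
    using assms(19,20)[of "I r"] quantile_in_support[OF that] cdf_quantile[OF that] by (simp_all add: F0)
  have G1: "G r 1 = ?m1 r" and G2: "G 1 r = ?m2 r" if "0 < r" "r \<le> 1" for r
  proof -
    have "G r 1 = ?m1 r \<and> G 1 r = ?m2 r"
    proof (cases "r = 1")
      case True
      then show ?thesis using pos \<open>G 1 1 = 1\<close> by (simp add: bprhm2_marginal_1)
    next
      case False
      with that assms(16,17)[of "I r"] N1_quantile[of r] N2_quantile[of r] show ?thesis
        by (simp add: F0 cdf_quantile)
    qed
    then show "G r 1 = ?m1 r" "G 1 r = ?m2 r" by auto
  qed
  \<comment> \<open>The formulas are needed under conditions on \<open>C x\<close> and \<open>C y\<close>.  These fix the order of \<open>x\<close> and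
    \<open>y\<close> except above the support, where \<open>C\<close> is constant and both forms of \<open>G\<close> agree.\<close>
  have F_upper: "F x y = C x powr (\<theta>1 + \<theta>2) * ?m2 (C y / C x)" if "0 < C y" "C y \<le> C x" for x y
  proof (cases "y \<le> x")
    case True
    with that assms(13,14)[of x y] G2[of "C y / C x"] \<open>\<theta> = _\<close> show ?thesis
      by (simp add: F0)
  next
    case False
    with that have "C x = C y"
      using monoD[OF mono, of x y] by simp
    with False that assms(13,15)[of x y] \<open>\<theta> = _\<close> \<open>G 1 1 = 1\<close> pos show ?thesis
      by (simp add: F0 bprhm2_marginal_1)
  qed
  have F_lower: "F x y = C y powr (\<theta>1 + \<theta>2) * ?m1 (C x / C y)" if "0 < C x" "C x < C y" for x y
  proof -
    have "x \<le> y"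
      using monoD[OF mono, of y x] that by linarith
    with that assms(13,15)[of x y] G1[of "C x / C y"] \<open>\<theta> = _\<close> show ?thesis
      by (simp add: F0)
  qed
  have F_cdf: "F x y = bprhm2_cdf \<theta>1 \<theta>2 \<theta>1' \<theta>2' (C x) (C y)" for x y
  proof (cases "C x \<le> 0 \<or> C y \<le> 0")
    case True
    have "F x y \<le> cdf ?N1 x" "F x y \<le> cdf ?N2 y"
      by (auto simp: assms(12) joint_cdf_def cdf_def measure_distr intro!: M.finite_measure_mono)
    moreover have "C x \<le> 0 \<Longrightarrow> cdf ?N1 x = 0"
      using pos by (intro cdf_eq_0_below_support[OF N1.real_distribution_axioms N1_quantile]
          bprhm2_marginal_tendsto_0)
    moreover have "C y \<le> 0 \<Longrightarrow> cdf ?N2 y = 0"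
      using pos by (intro cdf_eq_0_below_support[OF N2.real_distribution_axioms N2_quantile]
          bprhm2_marginal_tendsto_0)
    moreover have "0 \<le> F x y"
      by (simp add: assms(12) joint_cdf_def)
    ultimately show ?thesis
      using True by (auto simp: bprhm2_cdf_def)
  next
    case False
    then show ?thesis
      using F_upper[of y x] F_lower[of x y] by (auto simp: bprhm2_cdf_def)
  qed
  have "distr M (lborel \<Otimes>\<^sub>M lborel) (\<lambda>\<omega>. (Y1 \<omega>, Y2 \<omega>)) =
      density (lborel \<Otimes>\<^sub>M lborel)
        (\<lambda>(y1, y2). ennreal (bprhm2_density F0 f0 a b \<theta>1 \<theta>2 \<theta>1' \<theta>2' y1 y2))"
  proof (rule measure_eqI_lower_quadrants)
    show "finite_measure (distr M (lborel \<Otimes>\<^sub>M lborel) (\<lambda>\<omega>. (Y1 \<omega>, Y2 \<omega>)))"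
      by (rule M.finite_measure_distr) measurable
    fix x y
    have "(\<lambda>\<omega>. (Y1 \<omega>, Y2 \<omega>)) -` ({..x} \<times> {..y}) \<inter> space M = {\<omega> \<in> space M. Y1 \<omega> \<le> x \<and> Y2 \<omega> \<le> y}"
      by auto
    then have "emeasure (distr M (lborel \<Otimes>\<^sub>M lborel) (\<lambda>\<omega>. (Y1 \<omega>, Y2 \<omega>))) ({..x} \<times> {..y}) =
        ennreal (F x y)"
      by (subst emeasure_distr) (auto simp: assms(12) joint_cdf_def M.emeasure_eq_measure)
    also have "\<dots> = emeasure (density (lborel \<Otimes>\<^sub>M lborel)
        (\<lambda>(y1, y2). ennreal (bprhm2_density F0 f0 a b \<theta>1 \<theta>2 \<theta>1' \<theta>2' y1 y2))) ({..x} \<times> {..y})"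
      by (simp only: F_cdf F0 emeasure_bprhm2_box[OF pos])
    finally show "emeasure (distr M (lborel \<Otimes>\<^sub>M lborel) (\<lambda>\<omega>. (Y1 \<omega>, Y2 \<omega>))) ({..x} \<times> {..y}) =
      emeasure (density (lborel \<Otimes>\<^sub>M lborel)
        (\<lambda>(y1, y2). ennreal (bprhm2_density F0 f0 a b \<theta>1 \<theta>2 \<theta>1' \<theta>2' y1 y2))) ({..x} \<times> {..y})" .
  qed (simp_all add: lborel_prod)
  then have "has_BPRHM2 M Y1 Y2 F0 f0 a b \<theta>1 \<theta>2 \<theta>1' \<theta>2'"
    by (simp add: has_BPRHM2_def distributed_def F0 case_prod_beta')
  moreover have "AE x in ?N1. ereal x \<le> b" "AE x in ?N2. ereal x \<le> b"
    using assms(11) by (auto simp: AE_distr_iff elim: eventually_mono)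
  then have "ecdf ?N1 (baseline_inv D0 a b r) = ?m1 r" "ecdf ?N2 (baseline_inv D0 a b r) = ?m2 r"
    if "0 < r" "r \<le> 1" for r
    using that pos
    by (auto intro!: ecdf_baseline_inv N1.real_distribution_axioms N2.real_distribution_axioms
        N1_quantile N2_quantile bprhm2_marginal_1)
  moreover have "F x y = C y powr (\<theta>1 + \<theta>2) * ?m1 (C x / C y)" if "0 < C x" "C x \<le> C y" for x y
    using F_lower[of x y] F_upper[of y x] that pos
    by (cases "C x = C y") (auto simp: bprhm2_marginal_1)
  ultimately show ?thesis
    using F_upper by (auto simp: F0 monoD[OF mono])
qed

end
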